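(* Let $(E,d_E)$ be a complete separable metric space with Borel $\sigma$-algebra $\mathcal E$, let $\mu$ be a probability measure on $(E,\mathcal E)$, and let $\Phi,\widetilde\Phi\colon E\to\mathbb R$ belong to $L^1_\mu(\mathbb R)$ with $\operatorname{ess\,inf}_\mu\Phi=0$. Put $Z:=\int_E e^{-\Phi}\,d\mu$ and $\widetilde Z:=\int_E e^{-\widetilde\Phi}\,d\mu$ (both in $(0,\infty)$), and define the probability measures $$\mu_\Phi(dx):=\frac1Z e^{-\Phi(x)}\,\mu(dx),\qquad \mu_{\widetilde\Phi}(dx):=\frac1{\widetilde Z}e^{-\widetilde\Phi(x)}\,\mu(dx).$$ Then $$d_{\mathrm{KL}}(\mu_\Phi\|\mu_{\widetilde\Phi})\le\frac{2\exp\left(-[\operatorname{ess\,inf}_\mu\widetilde\Phi]_-\right)}{\min(Z,\widetilde Z)}\,\|\Phi-\widetilde\Phi\|_{L^1_\mu}.$$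
   Context: $[t]_-:=\min(0,t)$. The Kullback--Leibler divergence is $d_{\mathrm{KL}}(\mu\|\widetilde\mu):=\int_E\log\left(\frac{d\mu}{d\widetilde\mu}\right)d\mu$ if $\mu\ll\widetilde\mu$, and $+\infty$ otherwise. $L^1_\mu(\mathbb R)$ is the space of $\mu$-integrable real functions with norm $\|\cdot\|_{L^1_\mu}$. If $\operatorname{ess\,inf}_\mu\widetilde\Phi=-\infty$ the right-hand side is read as $+\infty$. *)

theory Defs
  imports "HOL-Probability.Probability"
begin

definition essinf :: "'a measure \<Rightarrow> ('a \<Rightarrow> real) \<Rightarrow> ereal" where
  "essinf M f = - esssup M (\<lambda>x. - ereal (f x))"

lemma essinf_eq_Sup:
  assumes [measurable]: "f \<in> borel_measurable M"
  shows "essinf M f = Sup {z. AE x in M. z \<le> ereal (f x)}"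
proof -
  have flip: "- ereal (f x) \<le> z \<longleftrightarrow> - z \<le> ereal (f x)" for x z
    by (cases z) auto
  have "{z. AE x in M. - ereal (f x) \<le> z} = uminus ` {z. AE x in M. z \<le> ereal (f x)}"
  proof (intro set_eqI iffI)
    fix z assume "z \<in> {z. AE x in M. - ereal (f x) \<le> z}"
    then have "- z \<in> {z. AE x in M. z \<le> ereal (f x)}" by (simp add: flip del: uminus_ereal.simps)
    then show "z \<in> uminus ` {z. AE x in M. z \<le> ereal (f x)}"
      by (metis ereal_uminus_uminus imageI)
  next
    fix z assume "z \<in> uminus ` {z. AE x in M. z \<le> ereal (f x)}"
    then show "z \<in> {z. AE x in M. - ereal (f x) \<le> z}"
      by (auto simp add: flip simp del: uminus_ereal.simps)
  qed
  moreover have "esssup M (\<lambda>x. - ereal (f x)) = Inf {z. AE x in M. - ereal (f x) \<le> z}"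
    by (rule esssup_eq_AE) measurable
  ultimately show ?thesis
    unfolding essinf_def by (simp only: ereal_Inf_uminus_image_eq ereal_uminus_uminus)
qed

definition normalization_const :: "'a measure \<Rightarrow> ('a \<Rightarrow> real) \<Rightarrow> real" where
  "normalization_const M \<Phi> = (\<integral>x. exp (- \<Phi> x) \<partial>M)"

definition gibbs :: "'a measure \<Rightarrow> ('a \<Rightarrow> real) \<Rightarrow> 'a measure" where
  "gibbs M \<Phi> = density M (\<lambda>x. ennreal (exp (- \<Phi> x) / normalization_const M \<Phi>))"

(* entropy_density (exp 1) N M is ln of the density of M with respect to N, so note the order of
   the arguments.  The integral is taken in the extended sense, as positive minus negative part,
   so that it is infinite (and not 0, as KL_divergence would give) when the log-density is not
   M-integrable; for probability measures the negative part is always finite. *)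
definition d_KL :: "'a measure \<Rightarrow> 'a measure \<Rightarrow> ereal" where
  "d_KL M N =
     (if absolutely_continuous N M
      then enn2ereal (\<integral>\<^sup>+x. ennreal (entropy_density (exp 1) N M x) \<partial>M)
         - enn2ereal (\<integral>\<^sup>+x. ennreal (- entropy_density (exp 1) N M x) \<partial>M)
      else \<infinity>)"

lemma d_KL_eq_KL_divergence:
  assumes "absolutely_continuous N M" and int: "integrable M (entropy_density (exp 1) N M)"
  shows "d_KL M N = ereal (KL_divergence (exp 1) N M)"
proof -
  let ?f = "entropy_density (exp 1) N M"
  have "(\<integral>\<^sup>+x. ennreal (?f x) \<partial>M) < \<infinity>" "(\<integral>\<^sup>+x. ennreal (- ?f x) \<partial>M) < \<infinity>"
    using int by (auto simp: real_integrable_def top.not_eq_extremum)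
  then show ?thesis
    unfolding d_KL_def KL_divergence_def real_lebesgue_integral_def[OF int]
    using assms(1) by (cases "\<integral>\<^sup>+x. ennreal (?f x) \<partial>M"; cases "\<integral>\<^sup>+x. ennreal (- ?f x) \<partial>M") auto
qed

lemma (in prob_space) normalization_const_pos:
  assumes "integrable M (\<lambda>x. exp (- \<Phi> x))"
  shows "0 < normalization_const M \<Phi>"
proof -
  have "normalization_const M \<Phi> \<noteq> 0"
  proof
    assume "normalization_const M \<Phi> = 0"
    then have "AE x in M. exp (- \<Phi> x) = 0"
      unfolding normalization_const_def
      by (subst (asm) integral_nonneg_eq_0_iff_AE[OF assms]) auto
    then show False by simp
  qed
  moreover have "0 \<le> normalization_const M \<Phi>"
    unfolding normalization_const_def by simp
  ultimately show ?thesis by simp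
qed

lemma (in prob_space) prob_space_gibbs:
  assumes int: "integrable M (\<lambda>x. exp (- \<Phi> x))"
  shows "prob_space (gibbs M \<Phi>)"
proof
  note [measurable] = borel_measurable_integrable[OF int]
  let ?Z = "normalization_const M \<Phi>"
  have Z: "0 < ?Z" using normalization_const_pos[OF int] .
  have "emeasure (gibbs M \<Phi>) (space (gibbs M \<Phi>)) = (\<integral>\<^sup>+x. ennreal (exp (- \<Phi> x) / ?Z) \<partial>M)"
    unfolding gibbs_def by (subst emeasure_density) (auto intro!: nn_integral_cong)
  also have "\<dots> = ennreal (\<integral>x. exp (- \<Phi> x) / ?Z \<partial>M)"
    using Z int by (intro nn_integral_eq_integral) auto
  also have "\<dots> = 1"
    using Z int by (simp add: normalization_const_def)
  finally show "emeasure (gibbs M \<Phi>) (space (gibbs M \<Phi>)) = 1" .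
qed

lemma (in prob_space) integrable_exp_neg:
  assumes [measurable]: "\<Phi> \<in> borel_measurable M" and inf: "essinf M \<Phi> > -\<infinity>"
  shows "integrable M (\<lambda>x. exp (- \<Phi> x))"
proof -
  obtain z where z: "z > -\<infinity>" "AE x in M. z \<le> ereal (\<Phi> x)"
    using inf unfolding essinf_eq_Sup[OF assms(1)] less_Sup_iff by auto
  then obtain c where c: "AE x in M. c \<le> \<Phi> x"
  proof (cases z)
    case PInf
    then show ?thesis using z that by auto
  qed (use z that in auto)
  show ?thesis
    by (rule integrable_const_bound[where B = "exp (- c)"]) (use c in auto)
qed

end

theory Submission
  imports Defs
begin

text \<open>The log-density of \<open>\<mu>\<^sub>\<Phi>\<close> with respect to \<open>\<mu>\<^sub>\<Phi>'\<close> is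
  \<open>\<Phi>' - \<Phi> + ln (Z' / Z)\<close>. Integrating it against \<open>\<mu>\<^sub>\<Phi>\<close>, the first part contributes at most
  \<open>\<parallel>\<Phi> - \<Phi>'\<parallel> / Z\<close> because \<open>exp (- \<Phi>) \<le> 1\<close>; the second is at most \<open>(Z' - Z) / Z\<close>, and
  \<open>Z' - Z\<close> is controlled by the Lipschitz bound for \<open>exp\<close> on the half-line where
  both \<open>- \<Phi>\<close> and \<open>- \<Phi>'\<close> take their values.\<close>

lemma AE_essinf_le:
  assumes [measurable]: "f \<in> borel_measurable M"
  shows "AE x in M. essinf M f \<le> ereal (f x)"
proof -
  have "AE x in M. - ereal (f x) \<le> esssup M (\<lambda>x. - ereal (f x))"
    by (rule esssup_AE)
  then show ?thesis
    unfolding essinf_def by eventually_elim (metis ereal_minus_le_minus ereal_uminus_uminus)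
qed

text \<open>By convexity the graph of \<open>exp (- s)\<close> lies above its tangent at
  \<open>t\<close>, whose slope has size \<open>exp (- t)\<close>, at most \<open>exp (- m)\<close>.
  The estimate is one-sided, so a lower bound on \<open>t\<close> alone controls it.\<close>

lemma exp_neg_diff_le:
  fixes s t m :: real
  assumes "m \<le> t"
  shows "exp (- t) - exp (- s) \<le> exp (- m) * \<bar>s - t\<bar>"
proof -
  have "exp (- t) - exp (- s) = exp (- t) * (1 - exp (t - s))"
    by (simp add: algebra_simps flip: exp_add)
  also have "\<dots> \<le> exp (- t) * \<bar>s - t\<bar>"
  proof (rule mult_left_mono)
    show "1 - exp (t - s) \<le> \<bar>s - t\<bar>"
      using exp_ge_add_one_self[of "t - s"] by linarith
  qed simp
  also have "\<dots> \<le> exp (- m) * \<bar>s - t\<bar>"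
    using assms by (intro mult_right_mono) auto
  finally show ?thesis .
qed

context prob_space
begin

text \<open>Pointwise exponential estimate, integrated. The one-sided form suffices because the
  logarithm of the ratio of constants only has to be bounded from above.\<close>

lemma normalization_const_diff_le:
  assumes "integrable M \<Phi>" "integrable M \<Phi>'"
    and "integrable M (\<lambda>x. exp (- \<Phi> x))" "integrable M (\<lambda>x. exp (- \<Phi>' x))"
    and "AE x in M. m \<le> \<Phi>' x"
  shows "normalization_const M \<Phi>' - normalization_const M \<Phi> \<le>
    exp (- m) * (\<integral>x. \<bar>\<Phi> x - \<Phi>' x\<bar> \<partial>M)"
proof -
  have "normalization_const M \<Phi>' - normalization_const M \<Phi> =
      (\<integral>x. exp (- \<Phi>' x) - exp (- \<Phi> x) \<partial>M)"
    using assms by (simp add: normalization_const_def)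
  also have "\<dots> \<le> (\<integral>x. exp (- m) * \<bar>\<Phi> x - \<Phi>' x\<bar> \<partial>M)"
  proof (rule integral_mono_AE)
    show "AE x in M. exp (- \<Phi>' x) - exp (- \<Phi> x) \<le> exp (- m) * \<bar>\<Phi> x - \<Phi>' x\<bar>"
      using assms(5) by eventually_elim (rule exp_neg_diff_le)
  qed (use assms in auto)
  finally show ?thesis by simp
qed

text \<open>Both measures have positive densities with respect to \<open>M\<close>, and their
  quotient is the relative density. Having it in explicit form lets uniqueness identify the
  Radon-Nikodym derivative.\<close>

lemma gibbs_eq_density_gibbs:
  assumes "integrable M (\<lambda>x. exp (- \<Phi> x))" "integrable M (\<lambda>x. exp (- \<Phi>' x))"
    and [measurable]: "\<Phi> \<in> borel_measurable M" "\<Phi>' \<in> borel_measurable M"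
  shows "gibbs M \<Phi> = density (gibbs M \<Phi>')
    (\<lambda>x. ennreal (exp (\<Phi>' x - \<Phi> x) * (normalization_const M \<Phi>' / normalization_const M \<Phi>)))"
proof -
  have Z: "0 < normalization_const M \<Phi>" "0 < normalization_const M \<Phi>'"
    using assms normalization_const_pos by auto
  show ?thesis
    unfolding gibbs_def using Z
    by (subst density_density_eq)
      (auto simp: field_simps simp flip: ennreal_mult exp_add intro!: density_cong)
qed

lemma AE_entropy_density_gibbs:
  assumes int: "integrable M (\<lambda>x. exp (- \<Phi> x))" "integrable M (\<lambda>x. exp (- \<Phi>' x))"
    and [measurable]: "\<Phi> \<in> borel_measurable M" "\<Phi>' \<in> borel_measurable M"
  shows "absolutely_continuous (gibbs M \<Phi>') (gibbs M \<Phi>)"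
    and "AE x in gibbs M \<Phi>. entropy_density (exp 1) (gibbs M \<Phi>') (gibbs M \<Phi>) x =
      \<Phi>' x - \<Phi> x + ln (normalization_const M \<Phi>' / normalization_const M \<Phi>)"
proof -
  let ?Z = "normalization_const M \<Phi>" and ?Z' = "normalization_const M \<Phi>'"
  have Z: "0 < ?Z" "0 < ?Z'"
    using int normalization_const_pos by auto
  interpret N: prob_space "gibbs M \<Phi>'"
    using int by (intro prob_space_gibbs)
  have sets [measurable_cong]: "sets (gibbs M \<Phi>') = sets M" "sets (gibbs M \<Phi>) = sets M"
    by (simp_all add: gibbs_def)
  let ?g = "\<lambda>x. ennreal (exp (\<Phi>' x - \<Phi> x) * (?Z' / ?Z))"
  have dens: "density (gibbs M \<Phi>') ?g = gibbs M \<Phi>"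
    using gibbs_eq_density_gibbs[OF assms] by simp
  show ac: "absolutely_continuous (gibbs M \<Phi>') (gibbs M \<Phi>)"
    by (subst dens[symmetric], rule absolutely_continuousI_density) measurable
  have "AE x in gibbs M \<Phi>'. ?g x = RN_deriv (gibbs M \<Phi>') (gibbs M \<Phi>) x"
    by (rule N.RN_deriv_unique[OF _ dens]) measurable
  \<comment> \<open>Uniqueness holds up to null sets of \<open>gibbs M \<Phi>'\<close>; absolute
    continuity makes them null for \<open>gibbs M \<Phi>\<close>, the measure against which the
    log-density is integrated.\<close>
  then have "AE x in gibbs M \<Phi>. ?g x = RN_deriv (gibbs M \<Phi>') (gibbs M \<Phi>) x"
    by (rule absolutely_continuous_AE[OF _ ac, rotated]) (simp add: sets)
  then show "AE x in gibbs M \<Phi>. entropy_density (exp 1) (gibbs M \<Phi>') (gibbs M \<Phi>) x =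
      \<Phi>' x - \<Phi> x + ln (?Z' / ?Z)"
  proof eventually_elim
    case (elim x)
    have "entropy_density (exp 1) (gibbs M \<Phi>') (gibbs M \<Phi>) x =
        ln (exp (\<Phi>' x - \<Phi> x) * (?Z' / ?Z))"
      using Z by (simp add: entropy_density_def log_def flip: elim)
    also have "\<dots> = \<Phi>' x - \<Phi> x + ln (?Z' / ?Z)"
      using Z by (subst ln_mult_pos) auto
    finally show ?case .
  qed
qed

text \<open>For nonnegative \<open>\<Phi>\<close> the density of the Gibbs measure is at most the
  reciprocal of the normalization constant, so its integrals are dominated by those over
  \<open>M\<close>.\<close>

lemma gibbs_integral_bound:
  fixes f :: "'a \<Rightarrow> real"
  assumes f: "integrable M f" and [measurable]: "\<Phi> \<in> borel_measurable M"
    and nonneg: "AE x in M. 0 \<le> \<Phi> x"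
  shows "integrable (gibbs M \<Phi>) f"
    and "(\<integral>x. f x \<partial>gibbs M \<Phi>) \<le> (\<integral>x. \<bar>f x\<bar> \<partial>M) / normalization_const M \<Phi>"
proof -
  let ?Z = "normalization_const M \<Phi>"
  note [measurable] = borel_measurable_integrable[OF f]
  \<comment> \<open>The weak inequality is enough below: division by zero yields zero, so the bounds
    survive \<open>?Z = 0\<close>.\<close>
  have Z: "0 \<le> ?Z"
    by (simp add: normalization_const_def)
  let ?h = "\<lambda>x. exp (- \<Phi> x) / ?Z * f x"
  have bound: "AE x in M. \<bar>?h x\<bar> \<le> \<bar>f x\<bar> / ?Z"
    using nonneg
  proof eventually_elim
    case (elim x)
    then have "exp (- \<Phi> x) * \<bar>f x\<bar> \<le> 1 * \<bar>f x\<bar>"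
      by (intro mult_right_mono) auto
    with Z show ?case
      by (simp add: abs_mult divide_right_mono)
  qed
  have int: "integrable M ?h"
    by (rule Bochner_Integration.integrable_bound[where f = "\<lambda>x. \<bar>f x\<bar> / ?Z"])
      (use f bound Z in auto)
  show "integrable (gibbs M \<Phi>) f"
    unfolding gibbs_def using int Z by (subst integrable_density) auto
  have "(\<integral>x. f x \<partial>gibbs M \<Phi>) = (\<integral>x. ?h x \<partial>M)"
    unfolding gibbs_def using Z by (subst integral_density) auto
  also have "\<dots> \<le> (\<integral>x. \<bar>f x\<bar> / ?Z \<partial>M)"
  proof (rule integral_mono_AE)
    show "AE x in M. ?h x \<le> \<bar>f x\<bar> / ?Z"
      using bound by eventually_elim linarith
  qed (use f int in auto)
  finally show "(\<integral>x. f x \<partial>gibbs M \<Phi>) \<le> (\<integral>x. \<bar>f x\<bar> \<partial>M) / ?Z"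
    by simp
qed

lemma d_KL_gibbs_le:
  assumes int: "integrable M \<Phi>" "integrable M \<Phi>'"
    and int_exp: "integrable M (\<lambda>x. exp (- \<Phi> x))" "integrable M (\<lambda>x. exp (- \<Phi>' x))"
    and nonneg: "AE x in M. 0 \<le> \<Phi> x"
    and m: "m \<le> 0" "AE x in M. m \<le> \<Phi>' x"
  shows "d_KL (gibbs M \<Phi>) (gibbs M \<Phi>') \<le>
    ereal (2 * exp (- m) / normalization_const M \<Phi> * (\<integral>x. \<bar>\<Phi> x - \<Phi>' x\<bar> \<partial>M))"
proof -
  let ?Z = "normalization_const M \<Phi>" and ?Z' = "normalization_const M \<Phi>'"
  let ?e = "entropy_density (exp 1) (gibbs M \<Phi>') (gibbs M \<Phi>)"
  let ?c = "ln (?Z' / ?Z)" and ?D = "\<integral>x. \<bar>\<Phi> x - \<Phi>' x\<bar> \<partial>M"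
  note [measurable] = borel_measurable_integrable[OF int(1)] borel_measurable_integrable[OF int(2)]
  have Z: "0 < ?Z" "0 < ?Z'"
    using int_exp normalization_const_pos by auto
  interpret G: prob_space "gibbs M \<Phi>"
    using int_exp by (intro prob_space_gibbs)
  have [measurable_cong]: "sets (gibbs M \<Phi>') = sets M" "sets (gibbs M \<Phi>) = sets M"
    by (simp_all add: gibbs_def)
  have [measurable]: "?e \<in> borel_measurable (gibbs M \<Phi>)"
    unfolding entropy_density_def by measurable
  note ed = AE_entropy_density_gibbs[OF int_exp]
  have D: "integrable (gibbs M \<Phi>) (\<lambda>x. \<Phi>' x - \<Phi> x)"
      "(\<integral>x. \<Phi>' x - \<Phi> x \<partial>gibbs M \<Phi>) \<le> (\<integral>x. \<bar>\<Phi>' x - \<Phi> x\<bar> \<partial>M) / ?Z"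
    using int nonneg by (intro gibbs_integral_bound; simp)+
  \<comment> \<open>Integrability turns the difference of positive and negative parts in
    \<open>d_KL\<close> into an ordinary integral.\<close>
  have "integrable (gibbs M \<Phi>) ?e"
    using D(1) by (subst integrable_cong_AE[OF _ _ ed(2)]) auto
  then have "d_KL (gibbs M \<Phi>) (gibbs M \<Phi>') = ereal (\<integral>x. ?e x \<partial>gibbs M \<Phi>)"
    using ed(1) by (subst d_KL_eq_KL_divergence) (auto simp: KL_divergence_def)
  also have "(\<integral>x. ?e x \<partial>gibbs M \<Phi>) = (\<integral>x. \<Phi>' x - \<Phi> x + ?c \<partial>gibbs M \<Phi>)"
    using ed(2) by (intro integral_cong_AE) auto
  also have "\<dots> = (\<integral>x. \<Phi>' x - \<Phi> x \<partial>gibbs M \<Phi>) + ?c"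
    using D(1) by (simp add: G.prob_space)
  also have "\<dots> \<le> ?D / ?Z + exp (- m) * ?D / ?Z"
  proof (rule add_mono)
    \<comment> \<open>This is \<open>ln t \<le> t - 1\<close> at
      \<open>t = ?Z' / ?Z\<close>.\<close>
    have "?c \<le> (?Z' - ?Z) / ?Z"
      using ln_le_minus_one[of "?Z' / ?Z"] Z by (simp add: field_simps)
    also have "\<dots> \<le> exp (- m) * ?D / ?Z"
      using Z normalization_const_diff_le[OF int int_exp m(2)] by (intro divide_right_mono) auto
    finally show "?c \<le> exp (- m) * ?D / ?Z" .
  qed (use D(2) in \<open>simp add: abs_minus_commute\<close>)
  \<comment> \<open>Since \<open>m \<le> 0\<close>, the factor \<open>exp (- m)\<close> is at least
    1; inserting it makes the two terms equal, which is the source of the constant 2.\<close>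
  also have "\<dots> \<le> exp (- m) * ?D / ?Z + exp (- m) * ?D / ?Z"
    using m Z mult_right_mono[of 1 "exp (- m)" ?D]
    by (intro add_right_mono divide_right_mono) auto
  also have "\<dots> = 2 * exp (- m) / ?Z * ?D"
    by simp
  finally show ?thesis by simp
qed

end

theorem theorem11:
  fixes \<mu> :: "'a::polish_space measure" and \<Phi> \<Phi>' :: "'a \<Rightarrow> real"
  assumes "prob_space \<mu>"
    and "sets \<mu> = sets borel"
    and "integrable \<mu> \<Phi>"
    and "integrable \<mu> \<Phi>'"
    and "essinf \<mu> \<Phi> = 0"
    and "integrable \<mu> (\<lambda>x. exp (- \<Phi>' x))"
  shows "d_KL (gibbs \<mu> \<Phi>) (gibbs \<mu> \<Phi>') \<le>
    (if essinf \<mu> \<Phi>' = -\<infinity> then \<infinity>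
     else ereal (2 * exp (- real_of_ereal (min 0 (essinf \<mu> \<Phi>')))
            / min (normalization_const \<mu> \<Phi>) (normalization_const \<mu> \<Phi>')
            * (\<integral>x. \<bar>\<Phi> x - \<Phi>' x\<bar> \<partial>\<mu>)))"
proof (cases "essinf \<mu> \<Phi>' = -\<infinity>")
  case False
  interpret prob_space \<mu> by fact
  let ?Z = "normalization_const \<mu> \<Phi>" and ?Z' = "normalization_const \<mu> \<Phi>'"
  let ?D = "\<integral>x. \<bar>\<Phi> x - \<Phi>' x\<bar> \<partial>\<mu>"
  have meas: "\<Phi> \<in> borel_measurable \<mu>" "\<Phi>' \<in> borel_measurable \<mu>"
    using assms by auto
  have int_exp: "integrable \<mu> (\<lambda>x. exp (- \<Phi> x))"
    using assms(5) by (intro integrable_exp_neg meas) simp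
  have nonneg: "AE x in \<mu>. 0 \<le> \<Phi> x"
    using AE_essinf_le[OF meas(1)] assms(5) by simp
  define m where "m = real_of_ereal (min 0 (essinf \<mu> \<Phi>'))"
  \<comment> \<open>The minimum with 0 rules out the value plus infinity and the case assumption
    rules out minus infinity, so \<open>real_of_ereal\<close> does not fall back to its default
    0.\<close>
  have m: "ereal m = min 0 (essinf \<mu> \<Phi>')"
    unfolding m_def using False by (cases "essinf \<mu> \<Phi>'") (auto simp: min_def)
  have "ereal m \<le> 0"
    unfolding m by simp
  then have "m \<le> 0"
    by simp
  have "AE x in \<mu>. m \<le> \<Phi>' x"
    using AE_essinf_le[OF meas(2)]
  proof eventually_elim
    case (elim x)
    then have "ereal m \<le> ereal (\<Phi>' x)"
      unfolding m by (simp add: min.coboundedI2)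
    then show ?case by simp
  qed
  with \<open>m \<le> 0\<close> have "d_KL (gibbs \<mu> \<Phi>) (gibbs \<mu> \<Phi>') \<le> ereal (2 * exp (- m) / ?Z * ?D)"
    using assms int_exp nonneg by (intro d_KL_gibbs_le)
  \<comment> \<open>The bound obtained so far has \<open>?Z\<close> in the denominator; passing to
    the smaller of the two positive constants only enlarges it.\<close>
  also have "2 * exp (- m) / ?Z * ?D \<le> 2 * exp (- m) / min ?Z ?Z' * ?D"
    using normalization_const_pos[OF int_exp] normalization_const_pos[OF assms(6)]
    by (intro mult_right_mono divide_left_mono) auto
  finally show ?thesis
    using False by (simp add: m_def)
qed simp

end
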